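(* For integers $r,n$ with $1<r<n$ let $$\mathbf{G}(r,n):=\frac{2\binom{r}{2}}{n^2}\sum_{k=r+1}^{n}\frac{k}{\binom{k-1}{2}}.$$ For $n\ge 3$, let $\mathcal{M}(n)$ denote a value of $r$ (integer, $1<r<n$) at which $\mathbf{G}(\cdot,n)$ reaches its maximum. Then: i) $\displaystyle\lim_{n\to\infty}\frac{\mathcal{M}(n)}{n}=\frac{1}{\sqrt e}$, i.e. $\mathcal{M}(n)\sim\frac{n}{\sqrt e}$. ii) $\displaystyle\lim_{n\to\infty}\mathbf{G}\left(\left[\frac{n}{\sqrt e}\right],n\right)=\frac1e$.
   Context: $[x]$ denotes the nearest integer to $x$. $\mathbf{G}(r,n)$ is the expected payoff in the best-or-worst secretary problem with $n$ objects when the first $r$ objects are rejected and then the first object better than all, or worse than all, preceding ones is chosen, the payoff being $k/n$ if the $k$-th object is chosen and it is the best or the worst of all, and $0$ otherwise. *)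

theory Defs
  imports Complex_Main "HOL-Library.Landau_Symbols"
begin

text \<open>The expected payoff of the best-or-worst secretary problem with \<open>n\<close> objects and rejection
  threshold \<open>r\<close>, for payoff \<open>k / n\<close> on selecting the \<open>k\<close>-th object.  The formula is meaningful
  for \<open>1 < r < n\<close>, where every \<open>(k - 1) choose 2\<close> in the sum is positive.\<close>

definition G :: "nat \<Rightarrow> nat \<Rightarrow> real" where
  "G r n = 2 * real (r choose 2) / (real n)\<^sup>2 *
             (\<Sum>k = r + 1..n. real k / real ((k - 1) choose 2))"

end

theory Submission
  imports Defs "HOL-Analysis.Elementary_Normed_Spaces"
begin

text \<open>With \<open>r = x n\<close> the payoff is a Riemann sum: since \<open>(k - 1) choose 2\<close> is about
  \<open>k\<^sup>2 / 2\<close>, it tends to \<open>2 x\<^sup>2 \<integral>\<^sub>x\<^sup>1 dt / t = -2 x\<^sup>2 ln x\<close>, whose maximum on \<open>(0, 1)\<close> is \<open>1 / e\<close>,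
  attained at \<open>x = 1 / sqrt e\<close> only.  Part ii) is continuity of this limit payoff.  For part i),
  pointwise convergence would not suffice, as the maximizers \<open>M n\<close> move with \<open>n\<close>; two quantitative
  facts together locate them.

  The first, \<open>G_near_limit_payoff\<close>, is that the limit payoff approximates \<open>G r n\<close> within
  \<open>6 / n\<close> uniformly in \<open>r\<close>.  The factor \<open>r (r - 1) / n\<^sup>2\<close> makes this possible: the sum itself is
  approximated only within \<open>3 / (r - 1)\<close>, which is poor for small \<open>r\<close>, but there the factor is
  small as well.  The second, \<open>limit_payoff_le\<close>, is that the limit payoff falls below \<open>1 / e\<close> at least
  quadratically in the distance from \<open>1 / sqrt e\<close>.  Hence, with \<open>r\<close> the integer nearest to
  \<open>n / sqrt e\<close>, \<open>(M n / n - 1 / sqrt e)\<^sup>2 \<le> 1 / e - G (M n) n + 6 / n \<le> 1 / e - G r n + 6 / n\<close>,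
  and the right-hand side vanishes in the limit by part ii).\<close>

definition limit_payoff :: "real \<Rightarrow> real" where
  "limit_payoff x = - 2 * x\<^sup>2 * ln x"

lemma real_choose_two: "real (m choose 2) = real m * (real m - 1) / 2"
proof (induction m)
  case (Suc m)
  have "Suc m choose 2 = m + (m choose 2)"
    by (simp add: numeral_2_eq_2)
  then show ?case
    using Suc.IH by (simp add: field_simps)
qed simp

lemma G_eq:
  assumes "1 < r"
  shows "G r n = 2 * (real r * (real r - 1)) / (real n)\<^sup>2 *
           (\<Sum>k = r + 1..n. real k / ((real k - 1) * (real k - 2)))"
proof -
  have term_eq: "real k / real ((k - 1) choose 2) = 2 * (real k / ((real k - 1) * (real k - 2)))"
    if "k \<in> {r + 1..n}" for k
    using that assms by (simp add: real_choose_two of_nat_diff)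
  have "(\<Sum>k = r + 1..n. real k / real ((k - 1) choose 2))
      = 2 * (\<Sum>k = r + 1..n. real k / ((real k - 1) * (real k - 2)))"
    by (simp only: sum_distrib_left sum.cong[OF refl term_eq])
  then show ?thesis
    unfolding G_def real_choose_two by simp
qed

text \<open>Each summand exceeds \<open>1 / (k - 1) \<ge> ln k - ln (k - 1)\<close>, and the logarithms telescope.\<close>

lemma ln_le_payoff_sum:
  assumes "1 < r" "r \<le> n"
  shows "ln (real n / real r) \<le> (\<Sum>k = r + 1..n. real k / ((real k - 1) * (real k - 2)))"
  using assms(2)
proof (induction n rule: dec_induct)
  case base
  then show ?case using assms by simp
next
  case (step m)
  have m: "real m > 1" using step assms by simp
  have "ln (real (Suc m) / real r) = ln (real m / real r) + ln (1 + 1 / real m)"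
    using m assms by (simp add: ln_div ln_mult field_simps flip: ln_mult)
  also have "ln (1 + 1 / real m) \<le> 1 / real m"
    using m by (intro ln_add_one_self_le_self) simp
  also have "1 / real m \<le> real (Suc m) / (real m * (real m - 1))"
    using m by (simp add: field_simps)
  finally show ?case
    using step by (simp add: algebra_simps)
qed

text \<open>Each summand equals \<open>1 / (k - 1) + 2 / ((k - 1) (k - 2))\<close>.  The first part is at most
  \<open>ln (k - 1) - ln (k - 2)\<close> and the second is \<open>2 / (k - 2) - 2 / (k - 1)\<close>, so both telescope.\<close>

lemma payoff_sum_le_telescoped:
  assumes "1 < r" "r \<le> n"
  shows "(\<Sum>k = r + 1..n. real k / ((real k - 1) * (real k - 2)))
       \<le> ln ((real n - 1) / (real r - 1)) + 2 / (real r - 1) - 2 / (real n - 1)"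
  using assms(2)
proof (induction n rule: dec_induct)
  case base
  then show ?case using assms by simp
next
  case (step m)
  have m: "real m > 1" and r: "real r > 1" using step assms by simp_all
  have "ln ((real m - 1) / real m) \<le> (real m - 1) / real m - 1"
    using m by (intro ln_le_minus_one) simp
  also have "\<dots> = - (1 / real m)"
    using m by (simp add: field_simps)
  finally have "1 / real m \<le> ln (real m) - ln (real m - 1)"
    using m by (simp add: ln_div)
  moreover have "real (Suc m) / (real m * (real m - 1))
      = 1 / real m + (2 / (real m - 1) - 2 / real m)"
    using m by (simp add: field_simps)
  moreover have "ln (real m / (real r - 1)) = ln (real m) - ln (real r - 1)"
    "ln ((real m - 1) / (real r - 1)) = ln (real m - 1) - ln (real r - 1)"
    using m r by (simp_all add: ln_div)
  ultimately show ?case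
    using step by simp
qed

lemma payoff_sum_le_ln:
  assumes "1 < r" "r \<le> n"
  shows "(\<Sum>k = r + 1..n. real k / ((real k - 1) * (real k - 2)))
       \<le> ln (real n / real r) + 3 / (real r - 1)"
proof -
  have r: "real r > 1" and n: "real n > 1" using assms by simp_all
  have "ln (real r / (real r - 1)) \<le> real r / (real r - 1) - 1"
    using r by (intro ln_le_minus_one) simp
  also have "\<dots> = 1 / (real r - 1)"
    using r by (simp add: field_simps)
  finally have "ln (real r) - ln (real r - 1) \<le> 1 / (real r - 1)"
    using r by (simp add: ln_div)
  moreover have "ln (real n - 1) \<le> ln (real n)" "0 \<le> 2 / (real n - 1)"
    using n by simp_all
  moreover have "3 / (real r - 1) = 2 / (real r - 1) + 1 / (real r - 1)"
    by (simp flip: add_divide_distrib)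
  moreover have "ln ((real n - 1) / (real r - 1)) = ln (real n - 1) - ln (real r - 1)"
    "ln (real n / real r) = ln (real n) - ln (real r)"
    using r n by (simp_all add: ln_div)
  ultimately show ?thesis
    using payoff_sum_le_telescoped[OF assms] by linarith
qed

text \<open>Two errors are made.  Replacing the sum by \<open>ln (n / r)\<close> lowers the payoff by at most
  \<open>2 r (r - 1) / n\<^sup>2 \<cdot> 3 / (r - 1) \<le> 6 / n\<close>; replacing \<open>r (r - 1)\<close> by \<open>r\<^sup>2\<close> then raises it by at
  most \<open>2 / n\<close>, because \<open>(r / n) ln (n / r) \<le> 1\<close>.  As the signs are opposite, the errors do not
  add up.\<close>

lemma G_near_limit_payoff:
  assumes "1 < r" "r \<le> n"
  shows "\<bar>G r n - limit_payoff (real r / real n)\<bar> \<le> 6 / real n"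
proof -
  define S where "S = (\<Sum>k = r + 1..n. real k / ((real k - 1) * (real k - 2)))"
  define L where "L = ln (real n / real r)"
  define c where "c = 2 * (real r * (real r - 1)) / (real n)\<^sup>2"
  have r: "real r > 1" and n: "real n > 0" and rn: "real r \<le> real n" using assms by simp_all
  define d where "d = 2 * real r * L / (real n)\<^sup>2"
  have G: "G r n = c * S"
    using G_eq[OF assms(1)] by (simp add: c_def S_def)
  have c0: "c \<ge> 0" using r by (simp add: c_def)
  have limit: "limit_payoff (real r / real n) = c * L + d"
    using r n
    by (simp add: limit_payoff_def c_def d_def L_def ln_div power2_eq_square field_simps)
  have S_lower: "c * L \<le> c * S"
    using ln_le_payoff_sum[OF assms] c0 by (simp add: S_def L_def mult_left_mono)
  have "c * S \<le> c * (L + 3 / (real r - 1))"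
    using payoff_sum_le_ln[OF assms] c0 unfolding S_def L_def by (intro mult_left_mono)
  also have "\<dots> = c * L + 6 * real r / (real n)\<^sup>2"
    using r n by (simp add: c_def field_simps)
  also have "6 * real r / (real n)\<^sup>2 \<le> 6 / real n"
    using rn n by (simp add: power2_eq_square field_simps)
  finally have S_upper: "c * S \<le> c * L + 6 / real n"
    by simp
  have "0 \<le> d"
    using r n rn by (simp add: d_def L_def)
  moreover have "d \<le> 6 / real n"
  proof -
    have "L \<le> real n / real r"
      using ln_le_minus_one[of "real n / real r"] r n by (simp add: L_def)
    then have "real r * L \<le> real n"
      using r by (simp add: field_simps)
    then have "d \<le> 2 / real n"
      using n by (simp add: d_def power2_eq_square field_simps)
    also have "\<dots> \<le> 6 / real n"
      using n by (simp add: field_simps)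
    finally show ?thesis .
  qed
  ultimately show ?thesis
    using S_lower S_upper unfolding G limit by linarith
qed

lemma limit_payoff_inverse_sqrt_exp: "limit_payoff (1 / sqrt (exp 1)) = 1 / exp 1"
  by (simp add: limit_payoff_def ln_div ln_sqrt power_divide)

text \<open>Apply \<open>ln y \<le> y - 1\<close> to the ratio \<open>y = a / x\<close> with \<open>a = 1 / sqrt e\<close>: as \<open>ln a = - 1 / 2\<close>, it
  gives \<open>- ln x \<le> a / x - 1 / 2\<close>, and \<open>2 x\<^sup>2\<close> times this is \<open>2 a x - x\<^sup>2 = a\<^sup>2 - (x - a)\<^sup>2\<close>.\<close>

lemma limit_payoff_le:
  assumes "x > 0"
  shows "limit_payoff x \<le> 1 / exp 1 - (x - 1 / sqrt (exp 1))\<^sup>2"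
proof -
  define a where "a = 1 / sqrt (exp (1 :: real))"
  have a: "a > 0" "ln a = - 1 / 2" "a\<^sup>2 = 1 / exp 1"
    by (simp_all add: a_def ln_div ln_sqrt power_divide)
  have "ln (a / x) \<le> a / x - 1"
    using a assms by (intro ln_le_minus_one) simp
  then have "- ln x \<le> a / x - 1 / 2"
    using a assms by (simp add: ln_div)
  then have "2 * x\<^sup>2 * - ln x \<le> 2 * x\<^sup>2 * (a / x - 1 / 2)"
    by (intro mult_left_mono) simp_all
  also have "\<dots> = a\<^sup>2 - (x - a)\<^sup>2"
    using assms by (simp add: field_simps power2_eq_square)
  finally show ?thesis
    using a by (simp add: limit_payoff_def a_def)
qed

lemma tendsto_round_mult_div:
  fixes a :: real
  assumes "a \<ge> 0"
  shows "(\<lambda>n. real (nat (round (real n * a))) / real n) \<longlonglongrightarrow> a"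
proof (rule Lim_transform)
  show "(\<lambda>n. a) \<longlonglongrightarrow> a" by simp
  show "(\<lambda>n. real (nat (round (real n * a))) / real n - a) \<longlonglongrightarrow> 0"
  proof (rule Lim_null_comparison)
    show "(\<lambda>n. 1 / real n) \<longlonglongrightarrow> 0" by (rule lim_1_over_n)
    show "\<forall>\<^sub>F n in sequentially. norm (real (nat (round (real n * a))) / real n - a) \<le> 1 / real n"
      using eventually_gt_at_top[of 0]
    proof eventually_elim
      case (elim n)
      have "0 \<le> round (real n * a)"
        using assms round_mono[of 0 "real n * a"] by simp
      then have "\<bar>real (nat (round (real n * a))) - real n * a\<bar> \<le> 1 / 2"
        using of_int_round_abs_le[of "real n * a"] by simp
      moreover have "real (nat (round (real n * a))) / real n - a
          = (real (nat (round (real n * a))) - real n * a) / real n"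
        using elim by (simp add: field_simps)
      ultimately show ?case
        using elim by (simp add: divide_right_mono)
    qed
  qed
qed

lemma tendsto_const_over_n: "(\<lambda>n. c / real n) \<longlonglongrightarrow> 0"
  using tendsto_mult_left[OF lim_1_over_n, of c] by simp

text \<open>The bound \<open>0 < x < 1\<close> puts \<open>r n\<close> strictly between \<open>1\<close> and \<open>n\<close> from some point on.\<close>

lemma eventually_threshold_admissible:
  assumes "(\<lambda>n. real (r n) / real n) \<longlonglongrightarrow> x" "0 < x" "x < 1"
  shows "\<forall>\<^sub>F n in sequentially. 1 < r n \<and> r n < n"
proof -
  have "(\<lambda>n. real (r n) / real n - 1 / real n) \<longlonglongrightarrow> x - 0"
    by (intro tendsto_diff assms(1) lim_1_over_n)
  then have "\<forall>\<^sub>F n in sequentially. 0 < real (r n) / real n - 1 / real n"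
    using assms(2) by (intro order_tendstoD(1)) simp_all
  moreover have "\<forall>\<^sub>F n in sequentially. real (r n) / real n < 1"
    using assms by (intro order_tendstoD(2))
  ultimately show ?thesis
    using eventually_gt_at_top[of 0]
    by eventually_elim (simp add: field_simps)
qed

lemma tendsto_G:
  assumes "(\<lambda>n. real (r n) / real n) \<longlonglongrightarrow> x" "0 < x" "x < 1"
  shows "(\<lambda>n. G (r n) n) \<longlonglongrightarrow> limit_payoff x"
proof (rule Lim_transform)
  show "(\<lambda>n. limit_payoff (real (r n) / real n)) \<longlonglongrightarrow> limit_payoff x"
    unfolding limit_payoff_def using assms by (intro tendsto_intros) simp_all
  show "(\<lambda>n. G (r n) n - limit_payoff (real (r n) / real n)) \<longlonglongrightarrow> 0"
  proof (rule Lim_null_comparison[OF _ tendsto_const_over_n])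
    show "\<forall>\<^sub>F n in sequentially. norm (G (r n) n - limit_payoff (real (r n) / real n)) \<le> 6 / real n"
      using eventually_threshold_admissible[OF assms]
      by eventually_elim (simp add: G_near_limit_payoff)
  qed
qed

theorem theorem6:
  fixes M :: "nat \<Rightarrow> nat"
  assumes "\<And>n. n \<ge> 3 \<Longrightarrow> is_arg_max (\<lambda>r. G r n) (\<lambda>r. 1 < r \<and> r < n) (M n)"
  shows "((\<lambda>n. real (M n) / real n) \<longlonglongrightarrow> 1 / sqrt (exp 1)
           \<and> (\<lambda>n. real (M n)) \<sim>[at_top] (\<lambda>n. real n / sqrt (exp 1)))
         \<and> (\<lambda>n. G (nat (round (real n / sqrt (exp 1)))) n) \<longlonglongrightarrow> 1 / exp 1"
proof -
  define a where "a = 1 / sqrt (exp (1 :: real))"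
  define r where "r n = nat (round (real n * a))" for n
  have "sqrt (exp 1) > 1" by simp
  then have a: "0 < a" "a < 1" by (simp_all add: a_def)
  have r: "(\<lambda>n. real (r n) / real n) \<longlonglongrightarrow> a"
    unfolding r_def using a by (intro tendsto_round_mult_div) simp
  have G_r: "(\<lambda>n. G (r n) n) \<longlonglongrightarrow> 1 / exp 1"
    using tendsto_G[OF r a] by (simp add: a_def limit_payoff_inverse_sqrt_exp)
  have "(\<lambda>n. (real (M n) / real n - a)\<^sup>2) \<longlonglongrightarrow> 0"
  proof (rule Lim_null_comparison)
    have "(\<lambda>n. 1 / exp 1 - G (r n) n + 6 / real n) \<longlonglongrightarrow> 1 / exp 1 - 1 / exp 1 + 0"
      by (intro tendsto_intros G_r tendsto_const_over_n)
    then show "(\<lambda>n. 1 / exp 1 - G (r n) n + 6 / real n) \<longlonglongrightarrow> 0"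
      by simp
    show "\<forall>\<^sub>F n in sequentially.
        norm ((real (M n) / real n - a)\<^sup>2) \<le> 1 / exp 1 - G (r n) n + 6 / real n"
      using eventually_threshold_admissible[OF r a] eventually_ge_at_top[of 3]
    proof eventually_elim
      case (elim n)
      have M: "1 < M n" "M n < n" "G (r n) n \<le> G (M n) n"
        using assms[OF elim(2)] elim(1) by (auto simp: is_arg_max_linorder)
      have "limit_payoff (real (M n) / real n) \<le> 1 / exp 1 - (real (M n) / real n - a)\<^sup>2"
        unfolding a_def using M elim by (intro limit_payoff_le) simp
      moreover have "\<bar>G (M n) n - limit_payoff (real (M n) / real n)\<bar> \<le> 6 / real n"
        using M by (intro G_near_limit_payoff) simp_all
      ultimately show ?case
        using M(3) by simp
    qed
  qed
  then have "(\<lambda>n. real (M n) / real n - a) \<longlonglongrightarrow> 0"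
    by simp
  then have M_lim: "(\<lambda>n. real (M n) / real n) \<longlonglongrightarrow> a"
    by (simp add: LIM_zero_iff)
  have "(\<lambda>n. real (M n) / real n / a) \<longlonglongrightarrow> a / a"
    using a by (intro tendsto_divide M_lim tendsto_const) simp
  then have "(\<lambda>n. real (M n) / (real n * a)) \<longlonglongrightarrow> 1"
    using a by simp
  then have "(\<lambda>n. real (M n)) \<sim>[at_top] (\<lambda>n. real n * a)"
    by (rule asymp_equivI')
  with M_lim G_r show ?thesis
    by (simp add: a_def r_def)
qed

end
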